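(* Up to isomorphism, there is a unique set $X \subseteq \mathbb{Z}_3^4$ such that the subgraph of $H(4,3)$ induced by $X$ has maximum degree $1$ and $|X| = 3^3 + 2$.
   Context: $H(4,3)$ is the Hamming graph on $\mathbb{Z}_3^4$ (vertices adjacent iff they differ in exactly one coordinate). Two subsets are isomorphic if some graph automorphism of $H(4,3)$ maps one onto the other. *)

theory Defs
  imports
    "HOL-Library.Numeral_Type"
    "HOL-Analysis.Finite_Cartesian_Product"
    "Graph_Theory.Graph_Theory"
begin

text \<open>
  A simple graph is represented as a loop-free symmetric digraph without parallel arcs
  (locale \<^locale>\<open>pair_graph\<close>): an edge is a pair of opposite arcs, so the degree of a vertex
  is its out-degree. The index type \<open>'n\<close> gives the dimension and \<open>'q\<close> the alphabet;
  \<open>\<int>\<^sub>3\<^sup>4\<close> is the type \<open>3 ^ 4\<close>, where the numeral type \<open>3\<close> is the ring of integers modulo 3.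
\<close>

definition hamming_graph :: "('q ^ 'n) pair_pre_digraph" where
  "hamming_graph = \<lparr> pverts = UNIV, parcs = {(x, y). card {i. x $ i \<noteq> y $ i} = 1} \<rparr>"

lemma pair_graph_hamming_graph: "pair_graph (hamming_graph :: ('q::finite ^ 'n) pair_pre_digraph)"
proof
  have "finite (UNIV :: ('q ^ 'n) set)" and "finite (UNIV :: (('q ^ 'n) \<times> ('q ^ 'n)) set)"
    by simp_all
  then show "finite (pverts (hamming_graph :: ('q ^ 'n) pair_pre_digraph))"
    and "finite (parcs (hamming_graph :: ('q ^ 'n) pair_pre_digraph))"
    by (blast intro: finite_subset)+
  show "symmetric (with_proj (hamming_graph :: ('q ^ 'n) pair_pre_digraph))"
    by (auto simp: symmetric_def hamming_graph_def sym_def eq_commute)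
qed (auto simp: hamming_graph_def)

text \<open>Junk value on graphs with no vertices or with unbounded degrees.\<close>

definition max_degree :: "('a, 'b) pre_digraph \<Rightarrow> nat" where
  "max_degree G = Max (out_degree G ` verts G)"

definition automorphism ::
    "('a, 'b) pre_digraph \<Rightarrow> ('a, 'b, 'a, 'b) digraph_isomorphism \<Rightarrow> bool" where
  "automorphism G h \<longleftrightarrow> pre_digraph.digraph_isomorphism G h \<and> app_iso h G = G"

definition isomorphic_subsets :: "('a, 'b) pre_digraph \<Rightarrow> 'a set \<Rightarrow> 'a set \<Rightarrow> bool" where
  "isomorphic_subsets G X Y \<longleftrightarrow> (\<exists>h. automorphism G h \<and> iso_verts h ` X = Y)"

text \<open>
  The arc component of an automorphism and its head and tail maps are determined by the vertex
  map, so automorphisms are just the adjacency-preserving and -reflecting permutations.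
\<close>

lemma isomorphic_subsets_hamming_graph_iff:
  fixes X Y :: "('q::finite ^ 'n) set"
  shows "isomorphic_subsets (with_proj hamming_graph) X Y \<longleftrightarrow>
    (\<exists>f. bij f \<and> (\<forall>x y. card {i. f x $ i \<noteq> f y $ i} = 1 \<longleftrightarrow> card {i. x $ i \<noteq> y $ i} = 1) \<and> f ` X = Y)"
  (is "?L \<longleftrightarrow> ?R")
proof
  let ?G = "with_proj (hamming_graph :: ('q ^ 'n) pair_pre_digraph)"
  let ?A = "parcs (hamming_graph :: ('q ^ 'n) pair_pre_digraph)"
  interpret H: pair_graph "hamming_graph :: ('q ^ 'n) pair_pre_digraph"
    by (rule pair_graph_hamming_graph)
  have A: "(x, y) \<in> ?A \<longleftrightarrow> card {i. x $ i \<noteq> y $ i} = 1" for x y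
    by (simp add: hamming_graph_def)
  have V: "verts ?G = UNIV" by (simp add: hamming_graph_def)
  {
    assume ?L
    then obtain h where h: "pre_digraph.digraph_isomorphism ?G h" "app_iso h ?G = ?G"
        and X: "iso_verts h ` X = Y"
      by (auto simp: isomorphic_subsets_def automorphism_def)
    let ?f = "iso_verts h"
    have "tail (app_iso h ?G) = fst" "head (app_iso h ?G) = snd"
      "verts (app_iso h ?G) = UNIV" "arcs (app_iso h ?G) = ?A"
      unfolding h(2) using V by simp_all
    then have T: "iso_tail h = fst" "iso_head h = snd" "range ?f = UNIV" "iso_arcs h ` ?A = ?A"
      using V by simp_all
    have inj: "inj ?f"
      using h(1) V by (simp add: pre_digraph.digraph_isomorphism_def)
    have ar: "iso_arcs h a = (?f (fst a), ?f (snd a))" if "a \<in> ?A" for a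
      using h(1) that T(1,2) by (auto simp: pre_digraph.digraph_isomorphism_def prod_eq_iff)
    have "(?f x, ?f y) \<in> ?A \<longleftrightarrow> (x, y) \<in> ?A" for x y
    proof
      assume "(?f x, ?f y) \<in> ?A"
      then obtain a where "a \<in> ?A" "(?f x, ?f y) = iso_arcs h a"
        using T(4) by blast
      then show "(x, y) \<in> ?A"
        using ar[of a] inj by (cases a) (auto dest: injD)
    next
      assume "(x, y) \<in> ?A"
      then show "(?f x, ?f y) \<in> ?A"
        using ar[of "(x, y)"] T(4) by (metis fst_conv imageI snd_conv)
    qed
    then show ?R
      using inj T(3) X A by (intro exI[of _ ?f]) (simp add: bij_def)
  next
    assume ?R
    then obtain f where f: "bij f" "\<And>x y. (f x, f y) \<in> ?A \<longleftrightarrow> (x, y) \<in> ?A" "f ` X = Y"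
      unfolding A by blast
    let ?h = "\<lparr> iso_verts = f, iso_arcs = map_prod f f, iso_head = snd, iso_tail = fst \<rparr>"
    have img: "map_prod f f ` ?A = ?A"
    proof
      show "map_prod f f ` ?A \<subseteq> ?A" using f(2) by auto
      show "?A \<subseteq> map_prod f f ` ?A"
      proof
        fix a assume a: "a \<in> ?A"
        obtain x y where "a = (f x, f y)"
          using bij_is_surj[OF f(1)] by (metis surjD surj_pair)
        then show "a \<in> map_prod f f ` ?A" using a f(2) by force
      qed
    qed
    have "pre_digraph.digraph_isomorphism ?G ?h"
      using bij_is_inj[OF f(1)] H.wf_digraph_axioms
      by (auto simp: pre_digraph.digraph_isomorphism_def V inj_on_def)
    moreover have "app_iso ?h ?G = ?G"
      using img bij_is_surj[OF f(1)] V by (simp add: app_iso_def with_proj_def)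
    ultimately show ?L
      using f(3) unfolding isomorphic_subsets_def automorphism_def
      by (intro exI[of _ ?h]) simp
  }
qed

end

theory Submission
  imports Defs
begin

text \<open>
  A set of maximum degree at most 1 in a 3 by 3 plane has at most 3 points unless it is the open
  neighbourhood \<open>N(c)\<close> of a point, all of whose points already have degree 1. Two neighbourhoods
  always meet, so at most one of three parallel planes carries one. Hence a three-dimensional cube
  contains at most 10 points, and if it contains 10, then one of its planes is some \<open>N(c)\<close> while the
  other two have 3 points and contain \<open>c\<close>. A set of size 29 therefore splits into cubes of sizes
  10, 10, 9. The neighbourhoods in the two cubes of size 10 lie in different columns and have
  centres that differ in both coordinates. Relabelling the symbols in every direction moves the
  centres to \<open>(0, 0)\<close> and \<open>(1, 1)\<close>, and then all nine planes are forced.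
\<close>

section \<open>Sparse sets in box products and their slices\<close>

definition box_adj ::
    "('a \<Rightarrow> 'a \<Rightarrow> bool) \<Rightarrow> ('b \<Rightarrow> 'b \<Rightarrow> bool) \<Rightarrow> 'a \<times> 'b \<Rightarrow> 'a \<times> 'b \<Rightarrow> bool" where
  "box_adj R Q x y \<longleftrightarrow> R (fst x) (fst y) \<and> snd x = snd y \<or> fst x = fst y \<and> Q (snd x) (snd y)"

text \<open>Inequality is the complete graph on each factor, so \<open>adj4\<close> over
  \<open>3\<close> is the Hamming graph. Pairs nest to the right so that the relational image of one
  first coordinate is a slice in the next smaller product.\<close>

abbreviation adj2 :: "'a \<times> 'b \<Rightarrow> 'a \<times> 'b \<Rightarrow> bool" where
  "adj2 \<equiv> box_adj (\<noteq>) (\<noteq>)"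

abbreviation adj3 :: "'a \<times> 'b \<times> 'c \<Rightarrow> 'a \<times> 'b \<times> 'c \<Rightarrow> bool" where
  "adj3 \<equiv> box_adj (\<noteq>) adj2"

abbreviation adj4 :: "'a \<times> 'b \<times> 'c \<times> 'd \<Rightarrow> 'a \<times> 'b \<times> 'c \<times> 'd \<Rightarrow> bool" where
  "adj4 \<equiv> box_adj (\<noteq>) adj3"

text \<open>Induced degree at most 1, phrased as uniqueness of neighbours: no counting is involved,
  and the property pulls back along injective homomorphisms.\<close>

definition sparse :: "('a \<Rightarrow> 'a \<Rightarrow> bool) \<Rightarrow> 'a set \<Rightarrow> bool" where
  "sparse R S \<longleftrightarrow> (\<forall>x\<in>S. \<forall>y\<in>S. \<forall>z\<in>S. R x y \<longrightarrow> R x z \<longrightarrow> y = z)"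

lemma sparseD: "sparse R S \<Longrightarrow> x \<in> S \<Longrightarrow> y \<in> S \<Longrightarrow> z \<in> S \<Longrightarrow> R x y \<Longrightarrow> R x z \<Longrightarrow> y = z"
  by (auto simp: sparse_def)

lemma sparse_vimage:
  assumes "sparse R S" "inj f" "\<And>x y. Q x y \<Longrightarrow> R (f x) (f y)"
  shows "sparse Q (f -` S)"
  using assms unfolding sparse_def inj_def by (metis vimageD)

lemma box_adj_map_prod:
  assumes "\<And>x y. R (f x) (f y) \<longleftrightarrow> R x y" "\<And>x y. Q (g x) (g y) \<longleftrightarrow> Q x y" "inj f" "inj g"
  shows "box_adj R Q (map_prod f g x) (map_prod f g y) \<longleftrightarrow> box_adj R Q x y"
  using assms by (cases x, cases y) (auto simp: box_adj_def dest: injD)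

lemma sparse_slice:
  assumes "sparse (box_adj R Q) S"
  shows "sparse Q (S `` {i})"
proof -
  have "y = z" if "(i, x) \<in> S" "(i, y) \<in> S" "(i, z) \<in> S" "Q x y" "Q x z" for x y z
  proof -
    have "(i, y) = (i, z)"
      by (rule sparseD[OF assms that(1-3)]) (simp_all add: box_adj_def that(4,5))
    then show ?thesis by simp
  qed
  then show ?thesis by (simp add: sparse_def)
qed

text \<open>The point \<open>p\<close> of slice \<open>i\<close> already has the neighbour
  \<open>q\<close> there; a copy of \<open>p\<close> in slice \<open>k\<close> would be a second
  one.\<close>

lemma sparse_other_slice:
  assumes "sparse (box_adj (\<noteq>) Q) S" "i \<noteq> k" "p \<in> S `` {i}" "q \<in> S `` {i}" "Q p q"
  shows "p \<notin> S `` {k}"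
proof
  assume "p \<in> S `` {k}"
  then have "(k, p) = (i, q)"
    using assms(2-5) by (intro sparseD[OF assms(1), of "(i, p)"]) (simp_all add: box_adj_def)
  then show False using assms(2) by simp
qed

lemma UNIV_3_eq: "(UNIV :: 3 set) = {0, 1, 2}"
  by (rule card_subset_eq[symmetric]) auto

lemma UNIV_4_eq: "(UNIV :: 4 set) = {0, 1, 2, 3}"
  by (rule card_subset_eq[symmetric]) auto

lemma third_element:
  fixes x y :: 3
  assumes "x \<noteq> y"
  obtains z where "z \<noteq> x" "z \<noteq> y" "UNIV = {x, y, z}"
proof -
  have "card (UNIV - {x, y}) = 1"
    using assms by (simp add: card_Diff_subset)
  then obtain z where "UNIV - {x, y} = {z}"
    by (auto simp: card_1_singleton_iff)
  then show thesis by (intro that[of z]) auto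
qed

lemma avoid_two:
  fixes x y :: 3
  obtains z where "z \<noteq> x" "z \<noteq> y"
proof -
  have "card {x, y} \<le> 2" by (simp add: card_insert_if)
  then have "card {x, y} \<noteq> CARD(3)" by simp
  then have "{x, y} \<noteq> UNIV" by metis
  then show thesis using that by blast
qed

lemma card_Compl_singleton: "card (- {x :: 3}) = 2"
  by (simp add: Compl_eq_Diff_UNIV card_Diff_subset)

lemma card_slices:
  fixes S :: "(3 \<times> 'a::finite) set"
  assumes "UNIV = {i, j, k}" "i \<noteq> j" "i \<noteq> k" "j \<noteq> k"
  shows "card S = card (S `` {i}) + card (S `` {j}) + card (S `` {k})"
proof -
  have "card S = card (SIGMA x:UNIV. S `` {x})"
    by (rule arg_cong[of _ _ card]) auto
  also have "\<dots> = (\<Sum>x\<in>{i, j, k}. card (S `` {x}))"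
    by (simp add: assms(1)[symmetric])
  also have "\<dots> = card (S `` {i}) + card (S `` {j}) + card (S `` {k})"
    using assms(2-4) by simp
  finally show ?thesis .
qed

subsection \<open>The rook's graph\<close>

definition nbhd :: "'a \<times> 'b \<Rightarrow> ('a \<times> 'b) set" where
  "nbhd c = {p. adj2 c p}"

text \<open>Neighbours in the rook's graph agree in exactly one coordinate, hence the exclusive
  or.\<close>

lemma mem_nbhd: "(a, b) \<in> nbhd (r, s) \<longleftrightarrow> (a = r) \<noteq> (b = s)"
  by (auto simp: nbhd_def box_adj_def)

lemma nbhd_eq: "nbhd (a, b) = {a} \<times> (- {b}) \<union> (- {a}) \<times> {b}"
  by (auto simp: mem_nbhd)

lemma card_nbhd: "card (nbhd (c :: 3 \<times> 3)) = 4"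
proof -
  obtain a b where c: "c = (a, b)" by (cases c)
  have "card (nbhd c) = card ({a} \<times> (- {b})) + card ((- {a}) \<times> {b})"
    unfolding c nbhd_eq by (intro card_Un_disjoint) auto
  then show ?thesis
    by (simp add: card_cartesian_product card_Compl_singleton)
qed

text \<open>A neighbourhood consists of two edges: the other two points in the row of
  \<open>c\<close>, and the other two in its column.\<close>

lemma nbhd_has_neighbour:
  assumes "p \<in> nbhd (c :: 3 \<times> 3)"
  obtains q where "q \<in> nbhd c" "adj2 p q"
proof -
  obtain a b where c: "c = (a, b)" by (cases c)
  obtain x y where p: "p = (x, y)" by (cases p)
  show thesis
  proof (cases "x = a")
    case True
    then have "y \<noteq> b" using assms c p by (simp add: mem_nbhd)
    then obtain z where "z \<noteq> y" "z \<noteq> b" by (rule third_element)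
    then show thesis using True c p by (intro that[of "(a, z)"]) (auto simp: mem_nbhd box_adj_def)
  next
    case False
    then have "y = b" using assms c p by (simp add: mem_nbhd)
    obtain z where "z \<noteq> x" "z \<noteq> a" using False by (rule third_element)
    then show thesis
      using \<open>y = b\<close> c p by (intro that[of "(z, b)"]) (auto simp: mem_nbhd box_adj_def)
  qed
qed

text \<open>Centres on a common line share a neighbour on that line; otherwise a corner of the
  rectangle they span is adjacent to both.\<close>

lemma nbhds_intersect:
  fixes c d :: "3 \<times> 3"
  shows "nbhd c \<inter> nbhd d \<noteq> {}"
proof -
  obtain a b where c: "c = (a, b)" by (cases c)
  obtain x y where d: "d = (x, y)" by (cases d)
  obtain z where z: "z \<noteq> b" "z \<noteq> y" by (rule avoid_two)
  obtain w where w: "w \<noteq> a" "w \<noteq> x" by (rule avoid_two)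
  consider "a = x" | "b = y" | "a \<noteq> x" "b \<noteq> y" by blast
  then show ?thesis
  proof cases
    case 1
    then have "(a, z) \<in> nbhd c \<inter> nbhd d" using c d z by (auto simp: mem_nbhd)
    then show ?thesis by blast
  next
    case 2
    then have "(w, b) \<in> nbhd c \<inter> nbhd d" using c d w by (auto simp: mem_nbhd)
    then show ?thesis by blast
  next
    case 3
    then have "(a, y) \<in> nbhd c \<inter> nbhd d" using c d by (auto simp: mem_nbhd)
    then show ?thesis by blast
  qed
qed

text \<open>If some row \<open>r\<close> contains two points, they use up each other's degree. So
  the row contains no third point and their columns no further point, and what remains lies in the
  third column \<open>z\<close>, off row \<open>r\<close>.\<close>

lemma sparse_plane_cases:
  fixes S :: "(3 \<times> 3) set"
  assumes S: "sparse adj2 S"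
  obtains "inj_on fst S" | r z where "S \<subseteq> nbhd (r, z)" "{r} \<times> (- {z}) \<subseteq> S"
proof (cases "inj_on fst S")
  case True
  then show ?thesis by (rule that)
next
  case False
  then obtain r x y where rx: "(r, x) \<in> S" and ry: "(r, y) \<in> S" and "x \<noteq> y"
    unfolding inj_on_def by fastforce
  obtain z where z: "z \<noteq> x" "z \<noteq> y" "UNIV = {x, y, z}"
    using \<open>x \<noteq> y\<close> by (rule third_element)
  have "(s, w) \<in> nbhd (r, z)" if sw: "(s, w) \<in> S" for s w
  proof -
    have "(s, w) = (r, y)" if "adj2 (r, x) (s, w)"
      by (rule sparseD[OF S rx sw ry that]) (simp add: box_adj_def \<open>x \<noteq> y\<close>)
    moreover have "(s, w) = (r, x)" if "adj2 (r, y) (s, w)"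
      by (rule sparseD[OF S ry sw rx that]) (simp add: box_adj_def \<open>x \<noteq> y\<close>[symmetric])
    moreover have "w = x \<or> w = y \<or> w = z" using z(3) by auto
    ultimately show ?thesis
      unfolding mem_nbhd box_adj_def fst_conv snd_conv using z(1,2) \<open>x \<noteq> y\<close> by blast
  qed
  moreover have "- {z} \<subseteq> {x, y}" using z(3) by blast
  then have "{r} \<times> (- {z}) \<subseteq> S"
    using rx ry by blast
  ultimately show ?thesis by (intro that(2)[of r z]) auto
qed

lemma sparse_plane_card:
  fixes S :: "(3 \<times> 3) set"
  assumes "sparse adj2 S" "\<And>c. S \<noteq> nbhd c"
  shows "card S \<le> 3"
  using assms(1)
proof (cases rule: sparse_plane_cases)
  case 1
  then have "card S \<le> card (UNIV :: 3 set)" by (intro card_inj_on_le) auto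
  then show ?thesis by simp
next
  case (2 r z)
  then have "S \<subset> nbhd (r, z)" using assms(2) by blast
  then have "card S < 4" using psubset_card_mono[of "nbhd (r, z)" S] by (simp add: card_nbhd)
  then show ?thesis by simp
qed

text \<open>If \<open>c\<close> were missing too, \<open>S\<close> would avoid the whole row and
  column of \<open>c\<close>. It would lie in a 2 by 2 grid, where a sparse set has at most two
  points.\<close>

lemma sparse_off_nbhd_contains_center:
  fixes S :: "(3 \<times> 3) set"
  assumes S: "sparse adj2 S" and disj: "S \<inter> nbhd c = {}" and "card S \<ge> 3"
  shows "c \<in> S"
proof (rule ccontr)
  assume "c \<notin> S"
  obtain a b where c: "c = (a, b)" by (cases c)
  have *: "x \<noteq> a \<and> y \<noteq> b" if "(x, y) \<in> S" for x y
    using that disj \<open>c \<notin> S\<close> by (auto simp: c mem_nbhd disjoint_iff)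
  from S have "card S \<le> 2"
  proof (cases rule: sparse_plane_cases)
    case 1
    then have "card S \<le> card (- {a})" by (intro card_inj_on_le[of fst]) (auto dest: *)
    then show ?thesis by (simp add: card_Compl_singleton)
  next
    case (2 r z)
    \<comment> \<open>Row \<open>r\<close> is filled except at \<open>z\<close>, whereas
      \<open>S\<close> misses column \<open>b\<close>.\<close>
    have "z = b"
    proof (rule ccontr)
      assume "z \<noteq> b"
      then have "(r, b) \<in> S" by (intro subsetD[OF 2(2)]) simp
      then show False using *[of r b] by simp
    qed
    have "x = r \<and> y \<noteq> z" if "(x, y) \<in> S" for x y
    proof -
      have "y \<noteq> z" using *[OF that] \<open>z = b\<close> by simp
      moreover have "(x, y) \<in> nbhd (r, z)" using 2(1) that by (rule subsetD)
      ultimately show ?thesis by (simp add: mem_nbhd)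
    qed
    then have "S \<subseteq> {r} \<times> (- {z})" by (simp add: subset_iff)
    then have "card S \<le> card ({r} \<times> (- {z}))" by (intro card_mono) auto
    then show ?thesis by (simp add: card_cartesian_product card_Compl_singleton)
  qed
  then show False using \<open>card S \<ge> 3\<close> by simp
qed

subsection \<open>Three parallel planes\<close>

text \<open>Every point of a neighbourhood is saturated inside its own plane, so no parallel plane
  repeats it.\<close>

lemma nbhd_slice_disjoint:
  fixes S :: "(3 \<times> 3 \<times> 3) set"
  assumes "sparse adj3 S" "S `` {i} = nbhd c" "i \<noteq> k"
  shows "S `` {k} \<inter> nbhd c = {}"
proof -
  have "p \<notin> S `` {k}" if "p \<in> nbhd c" for p
  proof -
    obtain q where "q \<in> nbhd c" "adj2 p q" using \<open>p \<in> nbhd c\<close> by (rule nbhd_has_neighbour)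
    then show ?thesis
      using assms(2,3) \<open>p \<in> nbhd c\<close> by (intro sparse_other_slice[OF assms(1), of i k p q]) auto
  qed
  then show ?thesis by blast
qed

lemma nbhd_slice_unique:
  fixes S :: "(3 \<times> 3 \<times> 3) set"
  assumes "sparse adj3 S" "S `` {i} = nbhd c" "S `` {k} = nbhd d"
  shows "i = k"
  using nbhd_slice_disjoint[OF assms(1,2), of k] nbhds_intersect[of c d] assms(3) by blast

lemma card_non_nbhd_slice:
  fixes S :: "(3 \<times> 3 \<times> 3) set"
  assumes "sparse adj3 S" "S `` {i} = nbhd c" "i \<noteq> k"
  shows "card (S `` {k}) \<le> 3"
  using assms nbhd_slice_unique sparse_slice sparse_plane_card by metis

lemma sparse_cube_card_gt_9:
  fixes S :: "(3 \<times> 3 \<times> 3) set"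
  assumes "sparse adj3 S" "card S > 9"
  obtains i c where "S `` {i} = nbhd c"
proof (rule ccontr)
  assume "\<not> thesis"
  then have "card (S `` {i}) \<le> 3" for i
    using sparse_plane_card[OF sparse_slice[OF assms(1)], of i] that by blast
  from this[of 0] this[of 1] this[of 2] show False
    using card_slices[OF UNIV_3_eq, of S] assms(2) by simp
qed

lemma sparse_cube_card_le:
  fixes S :: "(3 \<times> 3 \<times> 3) set"
  assumes S: "sparse adj3 S"
  shows "card S \<le> 10"
proof (rule ccontr)
  assume *: "\<not> ?thesis"
  then obtain i c where ic: "S `` {i} = nbhd c"
    using sparse_cube_card_gt_9[OF S] by auto
  obtain j where "j \<noteq> i" by (rule avoid_two[of i i])
  then obtain k where k: "k \<noteq> j" "k \<noteq> i" "UNIV = {j, i, k}" by (rule third_element)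
  show False
    using card_slices[OF k(3), of S] \<open>j \<noteq> i\<close> k(1,2) card_non_nbhd_slice[OF S ic, of j]
      card_non_nbhd_slice[OF S ic, of k] * by (simp add: ic card_nbhd)
qed

text \<open>Since 10 = 4 + 3 + 3, both bounds of 3 are attained, and a plane with three points off
  \<open>nbhd c\<close> must contain \<open>c\<close>.\<close>

lemma sparse_cube_card_10:
  fixes S :: "(3 \<times> 3 \<times> 3) set"
  assumes S: "sparse adj3 S" and card: "card S = 10" and ic: "S `` {i} = nbhd c" and "i \<noteq> k"
  shows "card (S `` {k}) = 3" "c \<in> S `` {k}"
proof -
  obtain j where j: "j \<noteq> i" "j \<noteq> k" "UNIV = {i, k, j}" using \<open>i \<noteq> k\<close> by (rule third_element)
  show *: "card (S `` {k}) = 3"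
    using card_slices[OF j(3), of S] j(1,2) \<open>i \<noteq> k\<close> card_non_nbhd_slice[OF S ic, of j]
      card_non_nbhd_slice[OF S ic, of k] card by (simp add: ic card_nbhd)
  show "c \<in> S `` {k}"
    using nbhd_slice_disjoint[OF S ic \<open>i \<noteq> k\<close>] sparse_slice[OF S] *
    by (intro sparse_off_nbhd_contains_center) auto
qed

subsection \<open>Nine parallel planes\<close>

text \<open>Fixing the second coordinate also gives a cube. The nine planes thus form a 3 by 3 array
  whose rows and columns both obey the results on three parallel planes.\<close>

lemma sparse_column:
  assumes "sparse adj4 S"
  shows "sparse adj3 {(i, p). (i, j, p) \<in> S}"
proof -
  have "{(i, p). (i, j, p) \<in> S} = (\<lambda>(i, p). (i, j, p)) -` S"
    by auto
  moreover have "sparse adj3 ((\<lambda>(i, p). (i, j, p)) -` S)"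
    by (rule sparse_vimage[OF assms]) (auto simp: inj_def box_adj_def)
  ultimately show ?thesis by simp
qed

lemma slice_column: "{(i, p). (i, j, p) \<in> S} `` {i} = (S `` {i}) `` {j}"
  by auto

lemma all_3: "(\<forall>x::3. P x) \<longleftrightarrow> P 0 \<and> P 1 \<and> P 2"
  by (metis UNIV_3_eq UNIV_I empty_iff insertE)

lemma two_full_cubes:
  fixes S :: "(3 \<times> 3 \<times> 3 \<times> 3) set"
  assumes S: "sparse adj4 S" and card: "card S = 29"
  obtains i k j l a b x y where "i \<noteq> k" "j \<noteq> l" "a \<noteq> x" "b \<noteq> y"
    "card (S `` {i}) = 10" "card (S `` {k}) = 10"
    "(S `` {i}) `` {j} = nbhd (a, b)" "(S `` {k}) `` {l} = nbhd (x, y)"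
proof -
  have cube: "sparse adj3 (S `` {i})" for i by (rule sparse_slice[OF S])
  note le = sparse_cube_card_le[OF cube]
  have sum: "card (S `` {0}) + card (S `` {1}) + card (S `` {2}) = 29"
    unfolding card[symmetric] by (rule card_slices[OF UNIV_3_eq, symmetric]) simp_all
  have "\<exists>i k. i \<noteq> k \<and> card (S `` {i}) = 10 \<and> card (S `` {k}) = 10"
  proof (cases "card (S `` {0}) = 10")
    case True
    moreover have "card (S `` {1}) = 10 \<or> card (S `` {2}) = 10"
      using sum le[of 0] le[of 1] le[of 2] by linarith
    moreover have "(0 :: 3) \<noteq> 1" "(0 :: 3) \<noteq> 2" by simp_all
    ultimately show ?thesis by metis
  next
    case False
    then have "card (S `` {1}) = 10 \<and> card (S `` {2}) = 10"
      using sum le[of 0] le[of 1] le[of 2] by linarith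
    then show ?thesis by (intro exI[of _ 1] exI[of _ 2]) simp
  qed
  then obtain i k where ik: "i \<noteq> k" "card (S `` {i}) = 10" "card (S `` {k}) = 10"
    by blast
  have gt: "card (S `` {i}) > 9" "card (S `` {k}) > 9" using ik(2,3) by simp_all
  obtain j c where jc: "(S `` {i}) `` {j} = nbhd c"
    by (rule sparse_cube_card_gt_9[OF cube gt(1)])
  obtain l d where ld: "(S `` {k}) `` {l} = nbhd d"
    by (rule sparse_cube_card_gt_9[OF cube gt(2)])
  note column = sparse_column[OF S]
  \<comment> \<open>Otherwise column \<open>j\<close> would contain two neighbourhoods.\<close>
  have "j \<noteq> l"
    using nbhd_slice_unique[OF column, of j i c k d] ik(1) jc ld by (auto simp: slice_column)
  obtain m where m: "m \<noteq> j" "m \<noteq> l" using \<open>j \<noteq> l\<close> by (rule third_element)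
  note c_in = sparse_cube_card_10(2)[OF cube ik(2) jc]
  note d_in = sparse_cube_card_10(2)[OF cube ik(3) ld]
  \<comment> \<open>Row \<open>i\<close> has \<open>c\<close> in columns \<open>l\<close> and
    \<open>m\<close>, and row \<open>k\<close> has \<open>d\<close> in column \<open>m\<close>. If
    \<open>c = d\<close>, the point \<open>(i, m, c)\<close> has two neighbours.\<close>
  have "c \<noteq> d"
  proof
    assume "c = d"
    have "(i, l, c) = (k, m, c)"
      by (rule sparseD[OF S, of "(i, m, c)"])
        (use c_in[of l] c_in[of m] d_in[of m] m \<open>j \<noteq> l\<close> \<open>i \<noteq> k\<close> \<open>c = d\<close> in
          \<open>auto simp: box_adj_def\<close>)
    then show False using ik(1) by simp
  qed
  \<comment> \<open>In column \<open>l\<close>, plane \<open>k\<close> is \<open>nbhd d\<close>,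
    while plane \<open>i\<close> contains \<open>c\<close>. Being neither equal nor adjacent, the
    centres differ in both coordinates.\<close>
  moreover have "c \<notin> nbhd d"
    using nbhd_slice_disjoint[OF column, of l k d i] ik(1) ld c_in[of l] \<open>j \<noteq> l\<close>
    by (auto simp: slice_column)
  ultimately show thesis
    using ik \<open>j \<noteq> l\<close> jc ld
    by (cases c, cases d) (intro that[of i k j l "fst c" "fst d" "snd c" "snd d"]; auto simp: mem_nbhd)
qed

text \<open>Apart from the two neighbourhoods, each plane is the graph of a permutation of the three
  symbols: the identity or a transposition.\<close>

definition extremal_plane :: "3 \<Rightarrow> 3 \<Rightarrow> (3 \<times> 3) set" where
  "extremal_plane i j =
    (if i = j then if i = 2 then {(0, 1), (1, 0), (2, 2)} else nbhd (i, i)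
     else if i \<noteq> 2 \<and> j \<noteq> 2 then {(0, 0), (1, 1), (2, 2)}
     else if i = 0 \<or> j = 0 then {(0, 0), (1, 2), (2, 1)}
     else {(1, 1), (0, 2), (2, 0)})"

definition extremal_set :: "(3 \<times> 3 \<times> 3 \<times> 3) set" where
  "extremal_set = {(i, j, p). p \<in> extremal_plane i j}"

text \<open>Off \<open>nbhd (u, u)\<close> and \<open>(v, v)\<close> only four points remain. Having
  \<open>(w, w)\<close> would cost both \<open>(v, w)\<close> and \<open>(w, v)\<close>, leaving at
  most two points.\<close>

lemma plane_forced:
  fixes T :: "(3 \<times> 3) set"
  assumes uvw: "UNIV = {u, v, w}" "u \<noteq> v" "u \<noteq> w" "v \<noteq> w"
    and disj: "T \<inter> nbhd (u, u) = {}" and "(v, v) \<notin> T" and card: "card T = 3"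
    and no_path: "(w, w) \<in> T \<Longrightarrow> (v, w) \<notin> T \<and> (w, v) \<notin> T"
  shows "T = {(u, u), (v, w), (w, v)}"
proof -
  have T: "p = (u, u) \<or> p = (v, w) \<or> p = (w, v) \<or> p = (w, w)" if "p \<in> T" for p
  proof -
    obtain x y where p: "p = (x, y)" by (cases p)
    have "x = u \<or> x = v \<or> x = w" "y = u \<or> y = v \<or> y = w" using uvw(1) by blast+
    moreover have "(x = u) = (y = u)" using disj that unfolding p by (auto simp: mem_nbhd disjoint_iff)
    ultimately show ?thesis using that \<open>(v, v) \<notin> T\<close> uvw(2-4) unfolding p by auto
  qed
  have "(w, w) \<notin> T"
  proof
    assume "(w, w) \<in> T"
    then have "T \<subseteq> {(u, u), (w, w)}" using T no_path by blast
    then have "card T \<le> card {(u, u), (w, w)}" by (intro card_mono) auto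
    then show False using card by (simp add: card_insert_if split: if_splits)
  qed
  then have "T \<subseteq> {(u, u), (v, w), (w, v)}" using T by blast
  then show ?thesis by (rule card_subset_eq[rotated]) (use card uvw in auto)
qed

text \<open>The planes are determined in the order 01, 10, 02, 12, 20, 21, 22; a count of the last
  row precedes the last three.\<close>

lemma sparse_29_forced:
  fixes S :: "(3 \<times> 3 \<times> 3 \<times> 3) set"
  assumes S: "sparse adj4 S" and card: "card S = 29"
    and row: "card (S `` {0}) = 10" "card (S `` {1}) = 10"
    and M00: "(S `` {0}) `` {0} = nbhd (0, 0)" and M11: "(S `` {1}) `` {1} = nbhd (1, 1)"
  shows "S = extremal_set"
proof -
  define M where "M i j = (S `` {i}) `` {j}" for i j
  note cube = sparse_slice[OF S]
  note column = sparse_column[OF S]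
  note row0 = sparse_cube_card_10[OF cube row(1) M00, folded M_def]
  note row1 = sparse_cube_card_10[OF cube row(2) M11, folded M_def]
  note M00' = M00[folded slice_column] and M11' = M11[folded slice_column]
  note disj_row0 = nbhd_slice_disjoint[OF cube M00, folded M_def]
    and disj_row1 = nbhd_slice_disjoint[OF cube M11, folded M_def]
    and disj_col0 = nbhd_slice_disjoint[OF column M00', unfolded slice_column, folded M_def]
    and disj_col1 = nbhd_slice_disjoint[OF column M11', unfolded slice_column, folded M_def]
  \<comment> \<open>The next four facts all apply sparseness at \<open>(i, j, p)\<close>.
    \<open>corner\<close> and \<open>cross\<close> concern one neighbour along the row of planes and
    one along the column; \<open>row_step\<close> and \<open>col_step\<close> concern one neighbour
    in another plane and one inside the plane.\<close>
  have corner: "p \<notin> M k j" if "p \<in> M i j" "p \<in> M i l" "j \<noteq> l" "i \<noteq> k" for i j k l p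
  proof
    assume "p \<in> M k j"
    then have "(k, j, p) = (i, l, p)"
      using that by (intro sparseD[OF S, of "(i, j, p)"]) (auto simp: M_def box_adj_def)
    then show False using that by simp
  qed
  have cross: "p \<notin> M i j" if "p \<in> M i l" "p \<in> M k j" "j \<noteq> l" "i \<noteq> k" for i j k l p
  proof
    assume "p \<in> M i j"
    then have "(k, j, p) = (i, l, p)"
      using that by (intro sparseD[OF S, of "(i, j, p)"]) (auto simp: M_def box_adj_def)
    then show False using that by simp
  qed
  have row_step: "q \<notin> M i j" if "p \<in> M i j" "p \<in> M i l" "j \<noteq> l" "adj2 p q" for i j l p q
  proof
    assume "q \<in> M i j"
    then have "(i, j, q) = (i, l, p)"
      using that by (intro sparseD[OF S, of "(i, j, p)"]) (auto simp: M_def box_adj_def)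
    then show False using that by simp
  qed
  have col_step: "q \<notin> M i j" if "p \<in> M i j" "p \<in> M k j" "i \<noteq> k" "adj2 p q" for i j k p q
  proof
    assume "q \<in> M i j"
    then have "(i, j, q) = (k, j, p)"
      using that by (intro sparseD[OF S, of "(i, j, p)"]) (auto simp: M_def box_adj_def)
    then show False using that by simp
  qed
  \<comment> \<open>Avoiding both neighbourhoods means that the coordinates equal 0 together and
    equal 1 together, hence also 2.\<close>
  have diag: "T = {(0, 0), (1, 1), (2, 2)}"
    if "T \<inter> nbhd (0, 0) = {}" "T \<inter> nbhd (1, 1) = {}" "card T = 3" for T :: "(3 \<times> 3) set"
  proof -
    have "(x, y) \<in> {(0, 0), (1, 1), (2, 2)}" if "(x, y) \<in> T" for x y
    proof -
      have "(x = 0) = (y = 0)" "(x = 1) = (y = 1)"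
        using \<open>T \<inter> nbhd (0, 0) = {}\<close> \<open>T \<inter> nbhd (1, 1) = {}\<close> that
        by (auto simp: mem_nbhd disjoint_iff)
      moreover have "x = 0 \<or> x = 1 \<or> x = 2" "y = 0 \<or> y = 1 \<or> y = 2"
        using UNIV_3_eq by auto
      ultimately show ?thesis by auto
    qed
    then have "T \<subseteq> {(0, 0), (1, 1), (2, 2)}" by auto
    then show ?thesis by (rule card_subset_eq[rotated]) (use that(3) in auto)
  qed
  have M01: "M 0 1 = {(0, 0), (1, 1), (2, 2)}"
    by (intro diag disj_row0 disj_col1 row0) auto
  have M10: "M 1 0 = {(0, 0), (1, 1), (2, 2)}"
    by (intro diag disj_row1 disj_col0 row1) auto
  \<comment> \<open>This order exchanges the symbols 0 and 1, so that \<open>plane_forced\<close>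
    also serves the centre \<open>(1, 1)\<close>.\<close>
  have uvw: "(UNIV :: 3 set) = {1, 0, 2}" by (simp add: UNIV_3_eq insert_commute)
  have c02: "(0, 0) \<in> M 0 2" by (intro row0) auto
  have c12: "(1, 1) \<in> M 1 2" by (intro row1) auto
  have M02: "M 0 2 = {(0, 0), (1, 2), (2, 1)}"
  proof (rule plane_forced[OF UNIV_3_eq])
    show "M 0 2 \<inter> nbhd (0, 0) = {}" "card (M 0 2) = 3" by (auto intro!: disj_row0 row0)
    show "(1, 1) \<notin> M 0 2" by (rule corner[of _ 1 2 0]) (auto simp: M10 c12)
    show "(1, 2) \<notin> M 0 2 \<and> (2, 1) \<notin> M 0 2" if "(2, 2) \<in> M 0 2"
      using row_step[OF that, of 1] by (auto simp: M01 box_adj_def)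
  qed auto
  have M12: "M 1 2 = {(1, 1), (0, 2), (2, 0)}"
  proof (rule plane_forced[OF uvw])
    show "M 1 2 \<inter> nbhd (1, 1) = {}" "card (M 1 2) = 3" by (auto intro!: disj_row1 row1)
    show "(0, 0) \<notin> M 1 2" by (rule corner[of _ 0 2 1]) (auto simp: M01 c02)
    show "(0, 2) \<notin> M 1 2 \<and> (2, 0) \<notin> M 1 2" if "(2, 2) \<in> M 1 2"
      using row_step[OF that, of 0] by (auto simp: M10 box_adj_def)
  qed auto
  \<comment> \<open>The three sets cover the plane. The alternative is kept open because
    disjointness is derived twice: first if \<open>M 2 2\<close> is a neighbourhood, later in
    general.\<close>
  have sub22: "M 2 2 \<subseteq> {(0, 1), (1, 0), (2, 2)} \<or> \<not> M 2 2 \<inter> (M 0 2 \<union> M 1 2) = {}"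
  proof -
    have "\<forall>x y. (x, y) \<in> {(0, 1), (1, 0), (2, 2)} \<union> M 0 2 \<union> M 1 2"
      unfolding M02 M12 all_3 by simp
    then show ?thesis by auto
  qed
  \<comment> \<open>A neighbourhood would be disjoint from \<open>M 0 2\<close> and
    \<open>M 1 2\<close> in its column and so fit into three points.\<close>
  have "card (M 2 2) \<le> 3"
  proof (cases "\<exists>d. M 2 2 = nbhd d")
    case True
    then obtain d where "(S `` {2}) `` {2} = nbhd d" by (auto simp: M_def)
    note d = this[folded slice_column]
    have "M 0 2 \<inter> M 2 2 = {}" "M 1 2 \<inter> M 2 2 = {}"
      using nbhd_slice_disjoint[OF column d, of 0] nbhd_slice_disjoint[OF column d, of 1] d
      by (auto simp: slice_column M_def)
    then have "M 2 2 \<subseteq> {(0, 1), (1, 0), (2, 2)}" using sub22 by blast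
    then have "card (M 2 2) \<le> card {(0, 1), (1, 0), (2, 2) :: 3 \<times> 3}" by (intro card_mono) auto
    then show ?thesis by simp
  next
    case False
    then show ?thesis
      using sparse_plane_card[OF sparse_slice[OF cube]] unfolding M_def by blast
  qed
  moreover have "card (M 2 0) \<le> 3"
    using card_non_nbhd_slice[OF column M00', of 2, unfolded slice_column] by (simp add: M_def)
  moreover have "card (M 2 1) \<le> 3"
    using card_non_nbhd_slice[OF column M11', of 2, unfolded slice_column] by (simp add: M_def)
  \<comment> \<open>The last cube has 29 - 10 - 10 = 9 points, so all three bounds are
    attained.\<close>
  moreover have "card (M 2 0) + card (M 2 1) + card (M 2 2) = 9"
    using card_slices[OF UNIV_3_eq, of S] card_slices[OF UNIV_3_eq, of "S `` {2}"] row card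
    by (simp add: M_def)
  ultimately have card2: "card (M 2 0) = 3" "card (M 2 1) = 3" "card (M 2 2) = 3"
    by linarith+
  have M20: "M 2 0 = {(0, 0), (1, 2), (2, 1)}"
  proof (rule plane_forced[OF UNIV_3_eq])
    show "M 2 0 \<inter> nbhd (0, 0) = {}" by (auto intro!: disj_col0)
    show "(1, 1) \<notin> M 2 0" by (rule corner[of _ 1 0 2]) (auto simp: M10 M12)
    show "(1, 2) \<notin> M 2 0 \<and> (2, 1) \<notin> M 2 0" if "(2, 2) \<in> M 2 0"
      using col_step[OF that, of 1] by (auto simp: M10 box_adj_def)
  qed (auto simp: card2)
  have M21: "M 2 1 = {(1, 1), (0, 2), (2, 0)}"
  proof (rule plane_forced[OF uvw])
    show "M 2 1 \<inter> nbhd (1, 1) = {}" by (auto intro!: disj_col1)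
    show "(0, 0) \<notin> M 2 1" by (rule corner[of _ 0 1 2]) (auto simp: M01 M02)
    show "(0, 2) \<notin> M 2 1 \<and> (2, 0) \<notin> M 2 1" if "(2, 2) \<in> M 2 1"
      using col_step[OF that, of 0] by (auto simp: M01 box_adj_def)
  qed (auto simp: card2)
  \<comment> \<open>Each such \<open>p\<close> recurs in its row of planes, which excludes it by
    \<open>corner\<close>, or in the last row of planes, which excludes it by
    \<open>cross\<close>.\<close>
  have "p \<notin> M 2 2" if "p \<in> M 0 2 \<union> M 1 2" for p
  proof -
    have "p \<in> M 0 2 \<and> (p \<in> M 0 1 \<or> p \<in> M 2 0) \<or> p \<in> M 1 2 \<and> (p \<in> M 1 0 \<or> p \<in> M 2 1)"
      using that by (auto simp: M02 M12 M01 M10 M20 M21)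
    then show ?thesis
      using corner[of p 0 2 1 2] corner[of p 1 2 0 2] cross[of p 2 0 0 2] cross[of p 2 1 1 2] by auto
  qed
  then have "M 2 2 \<subseteq> {(0, 1), (1, 0), (2, 2)}" using sub22 by blast
  then have M22: "M 2 2 = {(0, 1), (1, 0), (2, 2)}"
    by (rule card_subset_eq[rotated]) (use card2 in auto)
  have "\<forall>i j. M i j = extremal_plane i j"
    unfolding all_3 extremal_plane_def using M00 M11
    by (simp add: M_def[of 0 0] M_def[of 1 1] M01 M02 M10 M12 M20 M21 M22)
  then show ?thesis by (auto simp: M_def extremal_set_def)
qed


section \<open>The extremal set is an example\<close>

lemma card_extremal_set: "card extremal_set = 29"
proof -
  have plane: "(extremal_set `` {i}) `` {j} = extremal_plane i j" for i j
    by (auto simp: extremal_set_def)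
  have "card (extremal_set `` {i}) =
      card (extremal_plane i 0) + card (extremal_plane i 1) + card (extremal_plane i 2)" for i
    unfolding plane[symmetric] by (rule card_slices[OF UNIV_3_eq]) simp_all
  moreover have "card extremal_set =
      card (extremal_set `` {0}) + card (extremal_set `` {1}) + card (extremal_set `` {2})"
    by (rule card_slices[OF UNIV_3_eq]) simp_all
  ultimately show ?thesis
    by (simp add: extremal_plane_def card_nbhd)
qed

text \<open>An explicit list lets the simplifier evaluate degrees at all 81 points; adding 1 or 2
  reaches the other two symbols.\<close>

definition neighbours :: "3 \<times> 3 \<times> 3 \<times> 3 \<Rightarrow> (3 \<times> 3 \<times> 3 \<times> 3) list" where
  "neighbours = (\<lambda>(i, j, a, b). [(i + 1, j, a, b), (i + 2, j, a, b), (i, j + 1, a, b), (i, j + 2, a, b),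
    (i, j, a + 1, b), (i, j, a + 2, b), (i, j, a, b + 1), (i, j, a, b + 2)])"

lemma neq_3_iff: "x \<noteq> y \<longleftrightarrow> y = x + 1 \<or> y = x + 2" for x y :: 3
proof -
  have "\<forall>x y :: 3. x \<noteq> y \<longleftrightarrow> y = x + 1 \<or> y = x + 2"
    unfolding all_3 by simp
  then show ?thesis by blast
qed

lemma set_neighbours: "set (neighbours x) = {y. adj4 x y}"
proof -
  have "(k, l, c, d) \<in> set (neighbours (i, j, a, b)) \<longleftrightarrow> adj4 (i, j, a, b) (k, l, c, d)"
    for i j k l a b c d
  proof -
    have "(k, l, c, d) \<in> set (neighbours (i, j, a, b)) \<longleftrightarrow>
        (k = i + 1 \<or> k = i + 2) \<and> j = l \<and> a = c \<and> b = d \<or>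
        i = k \<and> ((l = j + 1 \<or> l = j + 2) \<and> a = c \<and> b = d \<or>
        j = l \<and> ((c = a + 1 \<or> c = a + 2) \<and> b = d \<or> a = c \<and> (d = b + 1 \<or> d = b + 2)))"
      unfolding neighbours_def by auto
    then show ?thesis
      unfolding neq_3_iff[symmetric] by (simp add: box_adj_def conj_disj_distribL)
  qed
  then show ?thesis by (cases x) auto
qed

lemma sparse_extremal_set: "sparse adj4 extremal_set"
proof -
  have "\<forall>i j a b. (i, j, a, b) \<in> extremal_set \<longrightarrow>
      length (filter (\<lambda>y. y \<in> extremal_set) (neighbours (i, j, a, b))) \<le> 1"
    unfolding all_3 by (simp add: neighbours_def extremal_set_def extremal_plane_def mem_nbhd)
  then have le: "length (filter (\<lambda>y. y \<in> extremal_set) (neighbours x)) \<le> 1" if "x \<in> extremal_set" for x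
    using that by (cases x) blast
  have "y = z" if "x \<in> extremal_set" "y \<in> extremal_set" "z \<in> extremal_set" "adj4 x y" "adj4 x z"
    for x y z
  proof -
    have "{y, z} \<subseteq> set (filter (\<lambda>y. y \<in> extremal_set) (neighbours x))"
      using that by (simp add: set_neighbours)
    then have "card {y, z} \<le> 1"
      using le[OF that(1)] by (meson List.finite_set card_length card_mono le_trans)
    then show ?thesis by (simp add: card_insert_if split: if_splits)
  qed
  then show ?thesis unfolding sparse_def by blast
qed


subsection \<open>The Hamming graph\<close>

definition hamming_adj :: "'q ^ 'n \<Rightarrow> 'q ^ 'n \<Rightarrow> bool" where
  "hamming_adj x y \<longleftrightarrow> card {i. x $ i \<noteq> y $ i} = 1"

lemma out_degree_induced_hamming:
  assumes "x \<in> X"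
  shows "out_degree (with_proj hamming_graph \<restriction> X) x = card {y \<in> X. hamming_adj x y}"
proof -
  have "out_arcs (with_proj hamming_graph \<restriction> X) x = Pair x ` {y \<in> X. hamming_adj x y}"
    using assms by (auto simp: out_arcs_def hamming_graph_def hamming_adj_def)
  then show ?thesis
    by (simp add: out_degree_def card_image inj_on_def)
qed

lemma sparse_if_max_degree_1:
  fixes X :: "('q::finite ^ 'n) set"
  assumes "max_degree (with_proj hamming_graph \<restriction> X) = 1"
  shows "sparse hamming_adj X"
proof -
  have "y = z" if "x \<in> X" "y \<in> X" "z \<in> X" "hamming_adj x y" "hamming_adj x z" for x y z
  proof -
    have "out_degree (with_proj hamming_graph \<restriction> X) x \<le> 1"
      unfolding assms[symmetric] max_degree_def using \<open>x \<in> X\<close> by (intro Max_ge) auto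
    then have "card {w \<in> X. hamming_adj x w} \<le> 1"
      by (simp add: out_degree_induced_hamming \<open>x \<in> X\<close>)
    moreover have "card {y, z} \<le> card {w \<in> X. hamming_adj x w}"
      using that by (intro card_mono) auto
    ultimately show ?thesis by (simp add: card_insert_if split: if_splits)
  qed
  then show ?thesis unfolding sparse_def by blast
qed

text \<open>Sparseness bounds the degrees by 1, and the edge from \<open>x\<close> to
  \<open>y\<close> attains the bound.\<close>

lemma max_degree_1_if_sparse:
  fixes X :: "('q::finite ^ 'n) set"
  assumes sparse: "sparse hamming_adj X" and xy: "x \<in> X" "y \<in> X" "hamming_adj x y"
  shows "max_degree (with_proj hamming_graph \<restriction> X) = 1"
proof -
  have le: "card {w \<in> X. hamming_adj v w} \<le> 1" if "v \<in> X" for v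
    using sparseD[OF sparse that] by (auto simp: card_le_Suc0_iff_eq)
  have "{w \<in> X. hamming_adj x w} \<noteq> {}" using xy by blast
  then have "card {w \<in> X. hamming_adj x w} \<noteq> 0" by (subst card_0_eq) auto
  then have "card {w \<in> X. hamming_adj x w} = 1"
    using le[OF xy(1)] by linarith
  then have "1 \<in> out_degree (with_proj hamming_graph \<restriction> X) ` X"
    using xy(1) out_degree_induced_hamming[OF xy(1)] by (metis imageI)
  then show ?thesis
    unfolding max_degree_def
  proof (intro Max_eqI)
    fix d assume "d \<in> out_degree (with_proj hamming_graph \<restriction> X) ` verts (with_proj hamming_graph \<restriction> X)"
    then obtain v where "v \<in> X" "d = out_degree (with_proj hamming_graph \<restriction> X) v" by auto
    then show "d \<le> 1" using le[of v] out_degree_induced_hamming[of v X] by simp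
  qed auto
qed

section \<open>Coordinates and relabelling of symbols\<close>

definition coords :: "'q ^ 4 \<Rightarrow> 'q \<times> 'q \<times> 'q \<times> 'q" where
  "coords x = (x $ 0, x $ 1, x $ 2, x $ 3)"

lemma bij_coords: "bij coords"
proof (rule bijI)
  show "inj coords"
  proof (rule injI)
    fix x y :: "'q ^ 4" assume eq: "coords x = coords y"
    show "x = y"
    proof (rule vec_eq_iff[THEN iffD2, rule_format])
      fix i :: 4
      have "i = 0 \<or> i = 1 \<or> i = 2 \<or> i = 3" using UNIV_4_eq by auto
      then show "x $ i = y $ i" using eq by (elim disjE) (simp_all add: coords_def)
    qed
  qed
  show "surj coords"
  proof (rule surjI)
    fix p :: "'q \<times> 'q \<times> 'q \<times> 'q"
    show "coords (case p of (i, j, a, b) \<Rightarrow>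
        \<chi> k. if k = 0 then i else if k = 1 then j else if k = 2 then a else b) = p"
      by (cases p) (simp add: coords_def)
  qed
qed

text \<open>The Hamming distance is a sum of four indicators; both sides are compared in all 16
  cases.\<close>

lemma adj4_coords: "adj4 (coords x) (coords y) \<longleftrightarrow> hamming_adj x y"
proof -
  have sum: "(\<Sum>i\<in>UNIV. g i) = g 0 + g 1 + g 2 + g 3" for g :: "4 \<Rightarrow> nat"
    unfolding UNIV_4_eq by simp
  have "card {i. x $ i \<noteq> y $ i} = (\<Sum>i\<in>UNIV. of_bool (x $ i \<noteq> y $ i))"
    by simp
  then show ?thesis
    unfolding sum hamming_adj_def coords_def box_adj_def
    by (cases "x $ 0 = y $ 0"; cases "x $ 1 = y $ 1"; cases "x $ 2 = y $ 2"; cases "x $ 3 = y $ 3")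
      simp_all
qed

lemma permutation_3:
  fixes i k :: 3
  assumes "i \<noteq> k"
  obtains f :: "3 \<Rightarrow> 3" where "bij f" "f 0 = i" "f 1 = k"
proof -
  obtain m where m: "UNIV = {i, k, m}" using assms by (rule third_element)
  define f where "f x = (if x = 0 then i else if x = 1 then k else m)" for x :: 3
  have "f 0 = i" "f 1 = k" "f 2 = m" by (simp_all add: f_def)
  then have "surj f" using m by (metis UNIV_I empty_iff insertE surjI surj_def)
  then have "bij f" by (simp add: bij_def finite_UNIV_surj_inj)
  then show thesis by (rule that[OF _ \<open>f 0 = i\<close> \<open>f 1 = k\<close>])
qed

lemma bij_map_prod: "bij f \<Longrightarrow> bij g \<Longrightarrow> bij (map_prod f g)"
  by (simp add: bij_def prod.inj_map map_prod_surj)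

lemma card_vimage_bij: "bij f \<Longrightarrow> card (f -` A) = card A"
  by (intro card_vimage_inj) (auto simp: bij_def)

text \<open>Permuting the symbols separately in each coordinate preserves adjacency. The four
  permutations send 0 and 1 to the data of \<open>two_full_cubes\<close>, so the preimage meets the
  hypotheses of \<open>sparse_29_forced\<close>.\<close>

lemma sparse_29_relabelling:
  fixes S :: "(3 \<times> 3 \<times> 3 \<times> 3) set"
  assumes S: "sparse adj4 S" and card: "card S = 29"
  obtains F :: "3 \<times> 3 \<times> 3 \<times> 3 \<Rightarrow> 3 \<times> 3 \<times> 3 \<times> 3"
    where "bij F" "\<And>p q. adj4 (F p) (F q) \<longleftrightarrow> adj4 p q" "F -` S = extremal_set"
proof -
  obtain i k j l a b x y where neq: "i \<noteq> k" "j \<noteq> l" "a \<noteq> x" "b \<noteq> y"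
    and row: "card (S `` {i}) = 10" "card (S `` {k}) = 10"
    and nbhd: "(S `` {i}) `` {j} = nbhd (a, b)" "(S `` {k}) `` {l} = nbhd (x, y)"
    using two_full_cubes[OF S card] .
  obtain f :: "3 \<Rightarrow> 3" where f: "bij f" "f 0 = i" "f 1 = k" using neq(1) by (rule permutation_3)
  obtain g :: "3 \<Rightarrow> 3" where g: "bij g" "g 0 = j" "g 1 = l" using neq(2) by (rule permutation_3)
  obtain h :: "3 \<Rightarrow> 3" where h: "bij h" "h 0 = a" "h 1 = x" using neq(3) by (rule permutation_3)
  obtain h' :: "3 \<Rightarrow> 3" where h': "bij h'" "h' 0 = b" "h' 1 = y" using neq(4) by (rule permutation_3)
  note inj = f(1)[THEN bij_is_inj] g(1)[THEN bij_is_inj] h(1)[THEN bij_is_inj] h'(1)[THEN bij_is_inj]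
  define H where "H = map_prod h h'"
  define G where "G = map_prod g H"
  define F where "F = map_prod f G"
  have bij: "bij H" "bij G" "bij F"
    unfolding F_def G_def H_def using f(1) g(1) h(1) h'(1) by (simp_all add: bij_map_prod)
  have adj2: "adj2 (H p) (H q) \<longleftrightarrow> adj2 p q" for p q
    unfolding H_def by (rule box_adj_map_prod) (use inj in \<open>auto simp: inj_eq\<close>)
  have adj3: "adj3 (G p) (G q) \<longleftrightarrow> adj3 p q" for p q
    unfolding G_def by (rule box_adj_map_prod) (use inj bij in \<open>auto simp: inj_eq adj2 bij_is_inj\<close>)
  have adj4: "adj4 (F p) (F q) \<longleftrightarrow> adj4 p q" for p q
    unfolding F_def by (rule box_adj_map_prod) (use inj bij in \<open>auto simp: inj_eq adj3 bij_is_inj\<close>)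
  have slice: "(F -` S) `` {m} = G -` (S `` {f m})" for m
    by (auto simp: F_def)
  have plane: "((F -` S) `` {m}) `` {n} = H -` ((S `` {f m}) `` {g n})" for m n
    by (auto simp: F_def G_def)
  \<comment> \<open>As \<open>H\<close> is an automorphism of the rook's graph, it carries
    neighbourhoods to neighbourhoods of the image centres.\<close>
  have H_nbhd: "H -` nbhd (H p) = nbhd p" for p
    by (auto simp: nbhd_def adj2)
  have H_corners: "H (0, 0) = (a, b)" "H (1, 1) = (x, y)" by (simp_all add: H_def h h')
  have "F -` S = extremal_set"
  proof (rule sparse_29_forced)
    show "sparse adj4 (F -` S)" 
      by (rule sparse_vimage[OF S bij_is_inj[OF bij(3)]]) (simp add: adj4)
    show "card (F -` S) = 29" using card bij(3) by (simp add: card_vimage_bij)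
    show "card ((F -` S) `` {0}) = 10" "card ((F -` S) `` {1}) = 10"
      using row bij(2) by (simp_all add: slice f card_vimage_bij)
    show "((F -` S) `` {0}) `` {0} = nbhd (0, 0)" "((F -` S) `` {1}) `` {1} = nbhd (1, 1)"
      by (simp_all add: plane f g nbhd H_nbhd flip: H_corners)
  qed
  then show thesis by (rule that[OF bij(3) adj4])
qed

theorem theoremA1:
  shows "\<exists>X :: (3 ^ 4) set.
    (max_degree (with_proj hamming_graph \<restriction> X) = 1 \<and> card X = 3 ^ 3 + 2) \<and>
    (\<forall>Y :: (3 ^ 4) set. max_degree (with_proj hamming_graph \<restriction> Y) = 1 \<and> card Y = 3 ^ 3 + 2 \<longrightarrow>
      isomorphic_subsets (with_proj hamming_graph) X Y)"
proof (intro exI conjI allI impI)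
  define X :: "(3 ^ 4) set" where "X = coords -` extremal_set"
  note inj = bij_is_inj[OF bij_coords] and surj = bij_is_surj[OF bij_coords]
  \<comment> \<open>Two adjacent points of the plane \<open>nbhd (0, 0)\<close>, which provide the
    edge for maximum degree exactly 1.\<close>
  obtain x y where xy: "coords x = (0, 0, 0, 1 :: 3)" "coords y = (0, 0, 0, 2 :: 3)"
    using surj by (metis surjD)
  show "max_degree (with_proj hamming_graph \<restriction> X) = 1"
  proof (rule max_degree_1_if_sparse)
    show "sparse hamming_adj X"
      unfolding X_def using sparse_extremal_set inj by (rule sparse_vimage) (simp add: adj4_coords)
    show "x \<in> X" "y \<in> X"
      by (simp_all add: X_def xy extremal_set_def extremal_plane_def mem_nbhd)
    show "hamming_adj x y"
      unfolding adj4_coords[symmetric] xy by (simp add: box_adj_def)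
  qed
  show "card X = 3 ^ 3 + 2"
    by (simp add: X_def card_vimage_bij[OF bij_coords] card_extremal_set)
  fix Y :: "(3 ^ 4) set"
  assume Y: "max_degree (with_proj hamming_graph \<restriction> Y) = 1 \<and> card Y = 3 ^ 3 + 2"
  define T where "T = inv (coords :: 3 ^ 4 \<Rightarrow> _)"
  have T: "bij T" "coords (T p) = p" for p
    unfolding T_def by (rule bij_imp_bij_inv[OF bij_coords], rule surj_f_inv_f[OF surj])
  have "sparse adj4 (T -` Y)"
  proof (rule sparse_vimage[OF sparse_if_max_degree_1 bij_is_inj[OF T(1)]])
    show "max_degree (with_proj hamming_graph \<restriction> Y) = 1" using Y by blast
    show "hamming_adj (T p) (T q)" if "adj4 p q" for p q
      unfolding adj4_coords[symmetric] T(2) by (rule that)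
  qed
  then obtain F :: "3 \<times> 3 \<times> 3 \<times> 3 \<Rightarrow> 3 \<times> 3 \<times> 3 \<times> 3"
    where F: "bij F" "\<And>p q. adj4 (F p) (F q) \<longleftrightarrow> adj4 p q" "F -` T -` Y = extremal_set"
  proof (rule sparse_29_relabelling)
    show "card (T -` Y) = 29"
      using Y by (simp add: card_vimage_bij[OF T(1)])
  qed (rule that)
  \<comment> \<open>Pass to coordinates, relabel, and return: \<open>F\<close> pulls the coordinate
    form of \<open>Y\<close> back to \<open>extremal_set\<close>, so \<open>f\<close> pulls
    \<open>Y\<close> back to \<open>X\<close>.\<close>
  define f where "f = T \<circ> F \<circ> coords"
  have "bij f"
    unfolding f_def using T(1) F(1) bij_coords by (intro bij_comp)
  moreover have "hamming_adj (f u) (f v) \<longleftrightarrow> hamming_adj u v" for u v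
    by (simp add: f_def T F(2) flip: adj4_coords)
  moreover have "X = f -` Y"
    unfolding X_def f_def F(3)[symmetric] by (simp add: vimage_comp comp_assoc)
  then have "f ` X = Y"
    using bij_is_surj[OF \<open>bij f\<close>] by (simp add: surj_image_vimage_eq)
  ultimately show "isomorphic_subsets (with_proj hamming_graph) X Y"
    unfolding isomorphic_subsets_hamming_graph_iff hamming_adj_def by blast
qed

end
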